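(* Let $x_0\in\operatorname{dom}h$ and $\lambda>0$, and let $x_j,s_j,\tilde x_j,t_j$ be generated by PDCP with prox center $x_0$ and stepsize $\lambda$. Then for every $j\ge1$, $$\phi^\lambda(\tilde x_j)+f^*(s_j)+(h^\lambda)^*(-s_j)\le t_j.$$
   Context: Problem. $f,h:\mathbb R^n\to\mathbb R\cup\{+\infty\}$ are proper lower semicontinuous convex functions with $\operatorname{dom}h\subset\operatorname{dom}f$, and $\phi=f+h$. Assumptions: there is a map $f':\operatorname{dom}h\to\mathbb R^n$ with $f'(x)\in\partial f(x)$ for all $x\in\operatorname{dom}h$; $\|f'(x)\|\le M$ for all $x\in\operatorname{dom}h$, for some $M>0$; $\phi$ has a minimizer. Write $\ell_f(u;y)=f(y)+\langle f'(y),u-y\rangle$; $g^*$ denotes the convex conjugate of $g$. Let $h^\lambda(u)=h(u)+\frac1{2\lambda}\|u-x_0\|^2$ and $\phi^\lambda=f+h^\lambda$. PDCP (primal-dual cutting-plane, stopping test ignored): start with $\Gamma_1=\ell_f(\cdot;x_0)$. For $j=1,2,\dots$: (i) $x_j=\operatorname{argmin}_u\{\Gamma_j(u)+h^\lambda(u)\}$, $m_j=\min_u\{\Gamma_j(u)+h^\lambda(u)\}$, and $s_j\in\partial\Gamma_j(x_j)\cap(-\partial h^\lambda(x_j))$; (ii) a point $\tilde x_j$ is chosen with $\tilde x_1=x_1$ and $\phi^\lambda(\tilde x_j)\le\tau_{j-1}\phi^\lambda(\tilde x_{j-1})+(1-\tau_{j-1})\phi^\lambda(x_j)$ for $j\ge2$;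 $t_j=\phi^\lambda(\tilde x_j)-m_j$; (iii) $\tau_j\in[0,1]$ is selected, and $\Gamma_{j+1}$ is any proper lower semicontinuous convex function with $\Gamma_{j+1}\le f$ and $\Gamma_{j+1}\ge\tau_j\bar\Gamma_j+(1-\tau_j)\ell_f(\cdot;x_j)$, for some proper lower semicontinuous convex $\bar\Gamma_j\le f$ with $\bar\Gamma_j(x_j)=\Gamma_j(x_j)$ and $x_j=\operatorname{argmin}_u\{\bar\Gamma_j(u)+h^\lambda(u)\}$. *)

theory Defs
  imports "HOL-Analysis.Analysis"
begin

text \<open>
  Functions with values in the reals extended by plus infinity are rendered as
  \<open>ereal\<close>-valued functions; \<open>proper_fun\<close> excludes the value minus infinity.
  The arithmetic of \<^typ>\<open>ereal\<close> has \<open>0 * \<infinity> = 0\<close>.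
\<close>

definition effdom :: "('a \<Rightarrow> ereal) \<Rightarrow> 'a set" where
  "effdom g = {u. g u < \<infinity>}"

definition proper_fun :: "('a \<Rightarrow> ereal) \<Rightarrow> bool" where
  "proper_fun g \<longleftrightarrow> (\<forall>u. g u \<noteq> -\<infinity>) \<and> effdom g \<noteq> {}"

definition lsc_fun :: "('a::topological_space \<Rightarrow> ereal) \<Rightarrow> bool" where
  "lsc_fun g \<longleftrightarrow> (\<forall>u. g u \<le> Liminf (at u) g)"

definition convex_fun :: "('a::real_vector \<Rightarrow> ereal) \<Rightarrow> bool" where
  "convex_fun g \<longleftrightarrow>
    (\<forall>u v. \<forall>a\<ge>0. \<forall>b\<ge>0. a + b = 1 \<longrightarrow>
      g (a *\<^sub>R u + b *\<^sub>R v) \<le> ereal a * g u + ereal b * g v)"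

definition proper_lsc_convex :: "('a::real_normed_vector \<Rightarrow> ereal) \<Rightarrow> bool" where
  "proper_lsc_convex g \<longleftrightarrow> proper_fun g \<and> lsc_fun g \<and> convex_fun g"

definition subdiff :: "('a::real_inner \<Rightarrow> ereal) \<Rightarrow> 'a \<Rightarrow> 'a set" where
  "subdiff g y = {s. \<forall>u. g u \<ge> g y + ereal (s \<bullet> (u - y))}"

definition conjugate :: "('a::real_inner \<Rightarrow> ereal) \<Rightarrow> 'a \<Rightarrow> ereal" where
  "conjugate g s = (SUP u. ereal (s \<bullet> u) - g u)"

definition linearization :: "('a::real_inner \<Rightarrow> ereal) \<Rightarrow> ('a \<Rightarrow> 'a) \<Rightarrow> 'a \<Rightarrow> 'a \<Rightarrow> ereal" where
  "linearization f f' y = (\<lambda>u. f y + ereal (f' y \<bullet> (u - y)))"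

definition prox_reg :: "('a::real_normed_vector \<Rightarrow> ereal) \<Rightarrow> real \<Rightarrow> 'a \<Rightarrow> 'a \<Rightarrow> ereal" where
  "prox_reg h lam x0 = (\<lambda>u. h u + ereal (1 / (2 * lam) * (norm (u - x0))\<^sup>2))"

definition is_minimizer :: "('a \<Rightarrow> ereal) \<Rightarrow> 'a \<Rightarrow> bool" where
  "is_minimizer g y \<longleftrightarrow> is_arg_min g (\<lambda>_. True) y"

text \<open>
  The sequences below are the data of a run of the primal-dual cutting-plane method with
  prox center \<open>x0\<close> and stepsize \<open>lam\<close>: cuts \<open>\<Gamma>\<close>, minimizers \<open>x\<close>, subgradients \<open>s\<close>,
  auxiliary points \<open>xt\<close>, optimal values \<open>m\<close>, gaps \<open>t\<close> and weights \<open>\<tau>\<close>.  Iterations are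
  numbered from 1 and the entries with index 0 play no role.

  Minimizers of \<open>\<Gamma> j + prox_reg h lam x0\<close> are unique by strong convexity, so
  \<open>is_minimizer\<close> expresses that \<open>x j\<close> is the argmin.
\<close>

definition pdcp ::
  "('a::euclidean_space \<Rightarrow> ereal) \<Rightarrow> ('a \<Rightarrow> ereal) \<Rightarrow> ('a \<Rightarrow> 'a) \<Rightarrow> 'a \<Rightarrow> real \<Rightarrow>
   (nat \<Rightarrow> 'a \<Rightarrow> ereal) \<Rightarrow> (nat \<Rightarrow> 'a) \<Rightarrow> (nat \<Rightarrow> 'a) \<Rightarrow> (nat \<Rightarrow> 'a) \<Rightarrow>
   (nat \<Rightarrow> ereal) \<Rightarrow> (nat \<Rightarrow> ereal) \<Rightarrow> (nat \<Rightarrow> real) \<Rightarrow> bool" where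
  "pdcp f h f' x0 lam \<Gamma> x s xt m t \<tau> \<longleftrightarrow>
    (let hl = prox_reg h lam x0; phil = (\<lambda>u. f u + hl u) in
      \<Gamma> 1 = linearization f f' x0 \<and>
      (\<forall>j\<ge>1.
        is_minimizer (\<lambda>u. \<Gamma> j u + hl u) (x j) \<and>
        m j = (INF u. \<Gamma> j u + hl u) \<and>
        s j \<in> subdiff (\<Gamma> j) (x j) \<inter> uminus ` subdiff hl (x j)) \<and>
      xt 1 = x 1 \<and>
      (\<forall>j\<ge>2. phil (xt j) \<le>
        ereal (\<tau> (j - 1)) * phil (xt (j - 1)) + ereal (1 - \<tau> (j - 1)) * phil (x j)) \<and>
      (\<forall>j\<ge>1. t j = phil (xt j) - m j) \<and>
      (\<forall>j\<ge>1. \<tau> j \<in> {0..1}) \<and>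
      (\<forall>j\<ge>1.
        proper_lsc_convex (\<Gamma> (j + 1)) \<and>
        (\<forall>u. \<Gamma> (j + 1) u \<le> f u) \<and>
        (\<exists>\<Gamma>b. proper_lsc_convex \<Gamma>b \<and> (\<forall>u. \<Gamma>b u \<le> f u) \<and>
          \<Gamma>b (x j) = \<Gamma> j (x j) \<and>
          is_minimizer (\<lambda>u. \<Gamma>b u + hl u) (x j) \<and>
          (\<forall>u. \<Gamma> (j + 1) u \<ge>
            ereal (\<tau> j) * \<Gamma>b u + ereal (1 - \<tau> j) * linearization f f' (x j) u))))"

end

theory Submission
  imports Defs
begin

text \<open>
  A subgradient \<open>s\<close> of \<open>g\<close> at a point \<open>y\<close> where \<open>g\<close> is finite attains equality in the
  Fenchel--Young inequality, so \<open>g\<^sup>*(s) = \<langle>s, y\<rangle> - g(y)\<close>.  Since \<open>s\<^sub>j\<close> is a subgradient of the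
  cut \<open>\<Gamma>\<^sub>j\<close> at \<open>x\<^sub>j\<close> and \<open>-s\<^sub>j\<close> one of \<open>h\<^sup>\<lambda>\<close> at the same point, the inner products cancel
  and \<open>\<Gamma>\<^sub>j\<^sup>*(s\<^sub>j) + (h\<^sup>\<lambda>)\<^sup>*(-s\<^sub>j) = -(\<Gamma>\<^sub>j(x\<^sub>j) + h\<^sup>\<lambda>(x\<^sub>j)) = -m\<^sub>j\<close>.  The cut minorizes \<open>f\<close>, and
  conjugation reverses the order, so \<open>f\<^sup>*(s\<^sub>j) \<le> \<Gamma>\<^sub>j\<^sup>*(s\<^sub>j)\<close>; adding \<open>\<phi>\<^sup>\<lambda>\<close> at the auxiliary
  point turns \<open>-m\<^sub>j\<close> into \<open>t\<^sub>j\<close>.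

  What remains is to see that \<open>\<Gamma>\<^sub>j(x\<^sub>j)\<close> and \<open>h\<^sup>\<lambda>(x\<^sub>j)\<close> are real numbers, so that the
  cancellation is legitimate in extended arithmetic.  Neither value is \<open>-\<infinity>\<close>, because both
  functions are proper, and their sum is at most \<open>\<Gamma>\<^sub>j(x\<^sub>0) + h\<^sup>\<lambda>(x\<^sub>0) \<le> f(x\<^sub>0) + h(x\<^sub>0) < \<infinity>\<close>.
\<close>

lemma conjugate_antimono:
  assumes "\<And>u. g u \<le> k u"
  shows "conjugate k s \<le> conjugate g s"
  unfolding conjugate_def by (intro SUP_mono') (simp add: assms ereal_minus_mono)

text \<open>
  The nontrivial half of the equality case of the Fenchel--Young inequality.  Finiteness of
  \<open>g y\<close> matters: if \<open>g y\<close> were \<open>-\<infinity>\<close>, every \<open>s\<close> would be a subgradient at \<open>y\<close>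
  while the conjugate would be \<open>\<infinity>\<close>.
\<close>

lemma conjugate_subgradient_le:
  assumes s: "s \<in> subdiff g y" and fin: "g y = ereal r"
  shows "conjugate g s \<le> ereal (s \<bullet> y - r)"
  unfolding conjugate_def
proof (rule SUP_least)
  fix u
  have "ereal (r + s \<bullet> (u - y)) \<le> g u"
    using s fin unfolding subdiff_def by (auto dest: spec[where x = u])
  then have "ereal (s \<bullet> u) - g u \<le> ereal (s \<bullet> u) - ereal (r + s \<bullet> (u - y))"
    by (intro ereal_minus_mono) auto
  then show "ereal (s \<bullet> u) - g u \<le> ereal (s \<bullet> y - r)"
    by (simp add: inner_diff_right)
qed

lemma is_minimizer_le:
  fixes g :: "'a \<Rightarrow> ereal"
  assumes "is_minimizer g y"
  shows "g y \<le> g u"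
  using assms unfolding is_minimizer_def is_arg_min_def by (auto simp: not_less)

lemma is_minimizer_INF:
  fixes g :: "'a \<Rightarrow> ereal"
  assumes "is_minimizer g y"
  shows "(INF u. g u) = g y"
  by (intro antisym INF_lower INF_greatest is_minimizer_le[OF assms]) simp

text \<open>
  The optimality half of Fenchel duality for \<open>g + k\<close>: when subgradients of \<open>g\<close> and \<open>k\<close> at \<open>y\<close>
  sum to zero, their inner products with \<open>y\<close> cancel, which closes the duality gap.
\<close>

lemma conjugate_sum_le_minus_value:
  assumes "s \<in> subdiff g y" and "- s \<in> subdiff k y"
    and "g y = ereal a" and "k y = ereal b"
  shows "conjugate g s + conjugate k (- s) \<le> - (g y + k y)"
proof -
  have "conjugate g s + conjugate k (- s) \<le> ereal (s \<bullet> y - a) + ereal ((- s) \<bullet> y - b)"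
    by (intro add_mono conjugate_subgradient_le assms)
  then show ?thesis
    by (simp add: assms(3,4))
qed

text \<open>
  For the first cut, minorization is the subgradient inequality at the prox center, where \<open>f\<close>
  is finite; all later cuts are proper minorants by construction.
\<close>

lemma pdcp_cut_bounds:
  assumes run: "pdcp f h f' x0 lam \<Gamma> x s xt m t \<tau>"
    and f: "proper_fun f" and x0: "x0 \<in> effdom f" "f' x0 \<in> subdiff f x0"
    and j: "j \<ge> 1"
  shows "\<Gamma> j u \<le> f u" and "\<Gamma> j u \<noteq> -\<infinity>"
proof -
  have *: "\<Gamma> j u \<le> f u \<and> \<Gamma> j u \<noteq> -\<infinity>"
  proof (cases "j = 1")
    case True
    then have "\<Gamma> j = linearization f f' x0"
      using run unfolding pdcp_def Let_def by simp
    moreover have "f x0 \<noteq> -\<infinity>"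
      using f unfolding proper_fun_def by simp
    ultimately show ?thesis
      using x0(2) unfolding linearization_def subdiff_def by simp
  next
    case False
    then obtain i where i: "j = i + 1" "i \<ge> 1"
      using j by (intro that[of "j - 1"]) auto
    have "proper_lsc_convex (\<Gamma> (i + 1)) \<and> (\<forall>u. \<Gamma> (i + 1) u \<le> f u)"
      using run i(2) unfolding pdcp_def Let_def by blast
    then show ?thesis
      unfolding i(1) proper_lsc_convex_def proper_fun_def by blast
  qed
  show "\<Gamma> j u \<le> f u" and "\<Gamma> j u \<noteq> -\<infinity>"
    using * by simp_all
qed

theorem lemma2p1:
  fixes f h :: "real ^ 'n \<Rightarrow> ereal"
    and f' :: "real ^ 'n \<Rightarrow> real ^ 'n"
    and M lam :: real
    and x0 :: "real ^ 'n"
    and \<Gamma> :: "nat \<Rightarrow> real ^ 'n \<Rightarrow> ereal"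
    and x s xt :: "nat \<Rightarrow> real ^ 'n"
    and m t :: "nat \<Rightarrow> ereal"
    and \<tau> :: "nat \<Rightarrow> real"
    and j :: nat
  assumes "proper_lsc_convex f"
    and "proper_lsc_convex h"
    and "effdom h \<subseteq> effdom f"
    and "\<And>y. y \<in> effdom h \<Longrightarrow> f' y \<in> subdiff f y"
    and "M > 0"
    and "\<And>y. y \<in> effdom h \<Longrightarrow> norm (f' y) \<le> M"
    and "\<exists>z. is_minimizer (\<lambda>u. f u + h u) z"
    and "x0 \<in> effdom h"
    and "lam > 0"
    and "pdcp f h f' x0 lam \<Gamma> x s xt m t \<tau>"
    and "j \<ge> 1"
  shows "(f (xt j) + prox_reg h lam x0 (xt j))
           + conjugate f (s j) + conjugate (prox_reg h lam x0) (- s j) \<le> t j"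
proof -
  define hl where "hl = prox_reg h lam x0"
  have step: "is_minimizer (\<lambda>u. \<Gamma> j u + hl u) (x j)"
    "m j = (INF u. \<Gamma> j u + hl u)"
    "s j \<in> subdiff (\<Gamma> j) (x j)" "s j \<in> uminus ` subdiff hl (x j)"
    "t j = f (xt j) + hl (xt j) - m j"
    using assms(10,11) unfolding pdcp_def Let_def hl_def by blast+
  have s: "- s j \<in> subdiff hl (x j)"
    using step(4) by auto
  have x0: "x0 \<in> effdom f" "f' x0 \<in> subdiff f x0"
    using assms(3,4,8) by auto
  have f: "proper_fun f"
    using assms(1) unfolding proper_lsc_convex_def by simp
  note cut = pdcp_cut_bounds[OF assms(10) f x0 assms(11)]
  have hl: "hl u \<noteq> -\<infinity>" for u
    using assms(2) unfolding hl_def prox_reg_def proper_lsc_convex_def proper_fun_def by simp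

  \<comment> \<open>The prox term vanishes at its center, so comparing with \<open>x0\<close> bounds the minimum.\<close>
  have "\<Gamma> j (x j) + hl (x j) \<le> \<Gamma> j x0 + hl x0"
    using is_minimizer_le[OF step(1)] .
  also have "\<dots> \<le> f x0 + h x0"
    unfolding hl_def prox_reg_def using cut(1) by (auto intro: add_right_mono)
  also have "\<dots> < \<infinity>"
    using x0(1) assms(8) unfolding effdom_def by simp
  finally obtain a b where ab: "\<Gamma> j (x j) = ereal a" "hl (x j) = ereal b"
    using cut(2)[of "x j"] hl[of "x j"]
    by (cases "\<Gamma> j (x j)"; cases "hl (x j)") auto

  have "conjugate f (s j) + conjugate hl (- s j)
      \<le> conjugate (\<Gamma> j) (s j) + conjugate hl (- s j)"
    by (intro add_right_mono conjugate_antimono cut(1))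
  also have "\<dots> \<le> - m j"
    unfolding step(2) is_minimizer_INF[OF step(1)]
    by (rule conjugate_sum_le_minus_value[OF step(3) s ab])
  finally have "(f (xt j) + hl (xt j)) + (conjugate f (s j) + conjugate hl (- s j))
      \<le> (f (xt j) + hl (xt j)) + - m j"
    by (rule add_left_mono)
  then show ?thesis
    unfolding step(5) hl_def[symmetric] by (simp add: add.assoc minus_ereal_def)
qed

end
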